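(* Let $\mathcal{M}=(Q,\Sigma,\cdot,\circ)$ be an automaton in the class $\mathcal{S}_a$, with sink-state $e$. If there is a point $\xi\in\Sigma^\omega$ whose Schreier graph $\mathrm{Sch}(\xi)$ is infinite and such that $\lim_{n\to\infty}\psi_\xi(n)=\ell$ for some integer $\ell\geq 1$, then $\overline{\mathcal{T}}(\mathcal{M})$ tiles the discrete plane. Conversely, if $\overline{\mathcal{T}}(\mathcal{M})$ admits just aperiodic tilings (i.e. it tiles the discrete plane and none of its tilings is periodic), then there is an infinite Schreier graph $\mathrm{Sch}(\xi)$ for some $\xi\in\Sigma^\omega$.
   Context: A Mealy automaton is $\mathcal{M}=(Q,\Sigma,\cdot,\circ)$ with finite nonempty sets $Q$ (states) and $\Sigma$ (alphabet), a transition function $(q,a)\mapsto q\cdot a\in Q$ and a production function $(q,a)\mapsto q\circ a\in\Sigma$; write $q\xrightarrow{a|b}p$ when $q\cdot a=p$, $q\circ a=b$. Extend to words by $q\circ(a_1\cdots a_n)=(q\circ a_1)\big((q\cdot a_1)\circ(a_2\cdots a_n)\big)$ and $q\cdot(a_1\cdots a_n)=(\cdots(q\cdot a_1)\cdots)\cdot a_n$. It is invertible if each map $a\mapsto q\circ a$ is a permutation of $\Sigma$; then the states generate a group $\langle\mathcal{M}\rangle$ of automorphisms of the tree $\Sigma^*$, acting on $\Sigma^\omega$. The inverse automaton, with stateset the formal inverses $Q^{-1}$, has a transition $q^{-1}\xrightarrow{b|a}p^{-1}$ whenever $q\xrightarrow{a|b}p$; it describes the action of inverses. Put $\widetilde{Q}=Q\cup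 Q^{-1}$. $\mathcal{S}_a$ is the class of invertible Mealy automata having a sink-state $e$ (i.e. $e\cdot a=e$ and $e\circ a=a$ for all $a\in\Sigma$; it is unique) that is accessible from every state. The formal inverse $e^{-1}$ is identified with $e$. $\mathrm{Sch}(\xi)$ is the graph whose vertices are the points of the orbit of $\xi\in\Sigma^\omega$ under $\langle\mathcal{M}\rangle$, with an edge $\eta\xrightarrow{q}\eta'$ for $q\in\widetilde{Q}$ and $\eta'=q\circ\eta$; $d$ is its graph distance. For an infinite word $\eta$, $\eta[:n]$ is its prefix of length $n$. For an edge $f=\big(\eta\xrightarrow{q}\eta'\big)$ put $\lambda(f)=\min\{n\ge1: q\cdot\eta[:n]=e\}$ if such an $n$ exists, and $\lambda(f)=\infty$ otherwise. Let $B_\xi(n)$ be the (finite) set of edges $\eta\xrightarrow{q}\eta'$ of $\mathrm{Sch}(\xi)$ with $d(\xi,\eta)\le n$ or $d(\xi,\eta')\le n$, and $\psi_\xi(n)=\max\{\lambda(f):f\in B_\xi(n),\ \lambda(f)<\infty\}$. (The set is nonempty because of the edges labeled $e$.) A Wang tile is a quadruple $(t_w,t_s,t_e,t_n)$ of colors (west, south, east, north edges). A tileset $\mathcal{T}$ tiles the discrete plane if there is a tiling $f:\mathbb{Z}^2\to\mathcal{T}$ with $f(x,y)_e=f(x+1,y)_w$ and $f(x,y)_n=f(x,y+1)_s$ for all $(x,y)$. A tiling is periodic if there is a nonzero $v\in\mathbb{Z}^2$ with $f(t+v)=f(t)$ for all $t$; otherwise it is aperiodic. $\overline{\mathcal{T}}(\mathcal{M})$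 is the set of Wang tiles $(q,a,p,b)$ (west $q$, south $a$, east $p$, north $b$) for the transitions $q\xrightarrow{a|b}p$ of $\mathcal{M}$ with $q,p\in Q\setminus\{e\}$. *)

theory Defs
  imports
    Complex_Main
    "HOL-Library.Extended_Nat"
    "HOL-Library.Product_Plus"
    "HOL-Algebra.Bij"
    "HOL-Algebra.Generated_Groups"
begin

section \<open>Mealy automata\<close>

text \<open>The stateset is the whole type \<open>'q\<close> and the alphabet the whole type \<open>'a\<close>; finiteness is
  imposed through the type class \<open>finite\<close> in the theorem. \<open>next_state M q a\<close> is \<open>q \<cdot> a\<close>, and
  \<open>produce M q a\<close> is \<open>q \<circ> a\<close>.\<close>

record ('q, 'a) mealy =
  next_state :: "'q \<Rightarrow> 'a \<Rightarrow> 'q"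
  produce :: "'q \<Rightarrow> 'a \<Rightarrow> 'a"

definition next_state_word :: "('q, 'a) mealy \<Rightarrow> 'q \<Rightarrow> 'a list \<Rightarrow> 'q" where
  "next_state_word M q w = foldl (next_state M) q w"

primrec produce_word :: "('q, 'a) mealy \<Rightarrow> 'q \<Rightarrow> 'a list \<Rightarrow> 'a list" where
  "produce_word M q [] = []"
| "produce_word M q (a # w) = produce M q a # produce_word M (next_state M q a) w"

definition invertible_mealy :: "('q, 'a) mealy \<Rightarrow> bool" where
  "invertible_mealy M \<longleftrightarrow> (\<forall>q. bij (produce M q))"

definition is_sink :: "('q, 'a) mealy \<Rightarrow> 'q \<Rightarrow> bool" where
  "is_sink M e \<longleftrightarrow> (\<forall>a. next_state M e a = e \<and> produce M e a = a)"

definition class_Sa :: "('q, 'a) mealy set" where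
  "class_Sa = {M. invertible_mealy M \<and>
     (\<exists>e. is_sink M e \<and> (\<forall>q. \<exists>w. next_state_word M q w = e))}"

text \<open>The state \<open>q\<close> of \<open>inverse_mealy M\<close> stands for the formal inverse of the state \<open>q\<close> of \<open>M\<close>.\<close>

definition inverse_mealy :: "('q, 'a) mealy \<Rightarrow> ('q, 'a) mealy" where
  "inverse_mealy M =
    \<lparr>next_state = (\<lambda>q b. next_state M q (inv_into UNIV (produce M q) b)),
     produce = (\<lambda>q b. inv_into UNIV (produce M q) b)\<rparr>"

text \<open>\<open>Neg q\<close> is the formal inverse of \<open>q\<close>. Since the formal inverse of the sink \<open>e\<close> is identified
  with \<open>e\<close>, the element \<open>Neg e\<close> does not belong to \<open>signed_states e\<close>, and \<open>formal_inverse e e\<close>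
  is \<open>Pos e\<close>.\<close>

datatype 'q signed = Pos 'q | Neg 'q

definition formal_inverse :: "'q \<Rightarrow> 'q \<Rightarrow> 'q signed" where
  "formal_inverse e q = (if q = e then Pos e else Neg q)"

definition signed_states :: "'q \<Rightarrow> 'q signed set" where
  "signed_states e = range Pos \<union> range (formal_inverse e)"

text \<open>The union of an automaton with sink \<open>e\<close> and its inverse automaton.\<close>

definition signed_mealy :: "('q, 'a) mealy \<Rightarrow> 'q \<Rightarrow> ('q signed, 'a) mealy" where
  "signed_mealy M e =
    \<lparr>next_state = (\<lambda>s a. case s of
        Pos q \<Rightarrow> Pos (next_state M q a)
      | Neg q \<Rightarrow> formal_inverse e (next_state (inverse_mealy M) q a)),
     produce = (\<lambda>s a. case s of
        Pos q \<Rightarrow> produce M q a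
      | Neg q \<Rightarrow> produce (inverse_mealy M) q a)\<rparr>"


section \<open>The group of an automaton and its action on infinite words\<close>

definition word_prefix :: "(nat \<Rightarrow> 'a) \<Rightarrow> nat \<Rightarrow> 'a list" where
  "word_prefix \<eta> n = map \<eta> [0..<n]"

text \<open>The action on infinite words induced by a map on finite words that preserves lengths and
  common prefixes: \<open>n\<close>-th prefixes are mapped to \<open>n\<close>-th prefixes.\<close>

definition act_infinite :: "('a list \<Rightarrow> 'a list) \<Rightarrow> (nat \<Rightarrow> 'a) \<Rightarrow> (nat \<Rightarrow> 'a)" where
  "act_infinite g \<eta> = (\<lambda>n. g (word_prefix \<eta> (Suc n)) ! n)"

text \<open>The elements of the group generated by the states, inside the group of all bijections of the
  vertex set of the tree of finite words.\<close>

definition mealy_group :: "('q, 'a) mealy \<Rightarrow> ('a list \<Rightarrow> 'a list) set" where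
  "mealy_group M = generate (BijGroup UNIV) (range (produce_word M))"

definition mealy_orbit :: "('q, 'a) mealy \<Rightarrow> (nat \<Rightarrow> 'a) \<Rightarrow> (nat \<Rightarrow> 'a) set" where
  "mealy_orbit M \<xi> = (\<lambda>g. act_infinite g \<xi>) ` mealy_group M"


section \<open>Schreier graphs\<close>

text \<open>The edge from \<open>\<eta>\<close> to \<open>\<eta>'\<close> labelled \<open>s\<close> is the triple \<open>(\<eta>, s, \<eta>')\<close>.\<close>

type_synonym ('q, 'a) sch_edge = "(nat \<Rightarrow> 'a) \<times> 'q signed \<times> (nat \<Rightarrow> 'a)"

definition sch_vertices :: "('q, 'a) mealy \<Rightarrow> (nat \<Rightarrow> 'a) \<Rightarrow> (nat \<Rightarrow> 'a) set" where
  "sch_vertices M \<xi> = mealy_orbit M \<xi>"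

definition sch_edges :: "('q, 'a) mealy \<Rightarrow> 'q \<Rightarrow> (nat \<Rightarrow> 'a) \<Rightarrow> ('q, 'a) sch_edge set" where
  "sch_edges M e \<xi> =
    {(\<eta>, s, \<eta>'). \<eta> \<in> sch_vertices M \<xi> \<and> \<eta>' \<in> sch_vertices M \<xi> \<and> s \<in> signed_states e \<and>
       \<eta>' = act_infinite (produce_word (signed_mealy M e) s) \<eta>}"

definition sch_adj :: "('q, 'a) mealy \<Rightarrow> 'q \<Rightarrow> (nat \<Rightarrow> 'a) \<Rightarrow> ((nat \<Rightarrow> 'a) \<times> (nat \<Rightarrow> 'a)) set" where
  "sch_adj M e \<xi> = {(\<eta>, \<eta>'). \<exists>s. (\<eta>, s, \<eta>') \<in> sch_edges M e \<xi> \<or> (\<eta>', s, \<eta>) \<in> sch_edges M e \<xi>}"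

text \<open>Used only between vertices of the connected graph \<open>Sch(\<xi>)\<close>, so a walk always exists.\<close>

definition sch_dist :: "('q, 'a) mealy \<Rightarrow> 'q \<Rightarrow> (nat \<Rightarrow> 'a) \<Rightarrow> (nat \<Rightarrow> 'a) \<Rightarrow> (nat \<Rightarrow> 'a) \<Rightarrow> nat" where
  "sch_dist M e \<xi> \<eta> \<eta>' = (LEAST n. (\<eta>, \<eta>') \<in> sch_adj M e \<xi> ^^ n)"

definition sch_ball :: "('q, 'a) mealy \<Rightarrow> 'q \<Rightarrow> (nat \<Rightarrow> 'a) \<Rightarrow> nat \<Rightarrow> ('q, 'a) sch_edge set" where
  "sch_ball M e \<xi> n =
    {(\<eta>, s, \<eta>') \<in> sch_edges M e \<xi>. sch_dist M e \<xi> \<xi> \<eta> \<le> n \<or> sch_dist M e \<xi> \<xi> \<eta>' \<le> n}"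

definition edge_lambda :: "('q, 'a) mealy \<Rightarrow> 'q \<Rightarrow> ('q, 'a) sch_edge \<Rightarrow> enat" where
  "edge_lambda M e = (\<lambda>(\<eta>, s, \<eta>').
    let sinks = (\<lambda>n. n \<ge> 1 \<and> next_state_word (signed_mealy M e) s (word_prefix \<eta> n) = Pos e)
    in if \<exists>n. sinks n then enat (LEAST n. sinks n) else \<infinity>)"

definition sch_psi :: "('q, 'a) mealy \<Rightarrow> 'q \<Rightarrow> (nat \<Rightarrow> 'a) \<Rightarrow> nat \<Rightarrow> nat" where
  "sch_psi M e \<xi> n = Max {k. \<exists>f \<in> sch_ball M e \<xi> n. edge_lambda M e f = enat k}"


section \<open>Wang tilings\<close>

text \<open>West and east edges only ever meet each other, and so do south and north edges; hence the
  colours of vertical edges (\<open>'h\<close>) and of horizontal edges (\<open>'v\<close>) may live in different types.\<close>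

record ('h, 'v) wang_tile =
  west :: 'h
  south :: 'v
  east :: 'h
  north :: 'v

definition is_tiling :: "('h, 'v) wang_tile set \<Rightarrow> (int \<times> int \<Rightarrow> ('h, 'v) wang_tile) \<Rightarrow> bool" where
  "is_tiling T f \<longleftrightarrow> range f \<subseteq> T \<and>
    (\<forall>x y. east (f (x, y)) = west (f (x + 1, y)) \<and> north (f (x, y)) = south (f (x, y + 1)))"

definition tiles_plane :: "('h, 'v) wang_tile set \<Rightarrow> bool" where
  "tiles_plane T \<longleftrightarrow> (\<exists>f. is_tiling T f)"

definition periodic_tiling :: "(int \<times> int \<Rightarrow> ('h, 'v) wang_tile) \<Rightarrow> bool" where
  "periodic_tiling f \<longleftrightarrow> (\<exists>v. v \<noteq> 0 \<and> (\<forall>t. f (t + v) = f t))"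

definition mealy_tileset :: "('q, 'a) mealy \<Rightarrow> 'q \<Rightarrow> ('q, 'a) wang_tile set" where
  "mealy_tileset M e =
    {\<lparr>west = q, south = a, east = p, north = b\<rparr> | q a p b.
       next_state M q a = p \<and> produce M q a = b \<and> q \<noteq> e \<and> p \<noteq> e}"

end

theory Submission
  imports Defs "HOL-Library.Diagonal_Subsequence"
begin

text \<open>A tiling by \<open>mealy_tileset M e\<close> is the same thing as a space-time diagram of the automaton:
  every row shows a run that never visits the sink, and the letters above the row are the output of
  the run.  Hence, to the right of any column, the word above a row is the image of the word below
  it under the state where the run enters, and consecutive rows are consecutive points of a walk in
  a Schreier graph.

  Suppose that \<open>\<psi>\<close> is bounded by \<open>l\<close> on an infinite Schreier graph.  A state applied to a point of
  the orbit either falls into the sink within the first \<open>l\<close> letters, in which case it does not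
  touch the tail after position \<open>l\<close>, or it never reaches the sink, in which case its section acts on
  the tail by a run that avoids the sink (\<open>bounded_lambda_step\<close>).  A forward walk from \<open>\<xi>\<close>
  thus turns, once the edges of finite \<open>\<lambda>\<close> are deleted, into a sink-free walk on tails.  The
  forward orbit of \<open>\<xi>\<close> is infinite, because a finite forward orbit would be permuted by the states and so would be
  the whole orbit (\<open>infinite_forward_orbit\<close>).  A word has only finitely many words with the same
  tail, so infinitely many tails are reached by sink-free walks; as there are finitely many states,
  these walks are arbitrarily long (\<open>relpow_nonempty_of_infinite_reach\<close>).  A sink-free walk of
  length \<open>n\<close> is a strip of height \<open>n\<close> that is tiled towards the right, and a compactness argument
  (\<open>local_rule_compactness\<close>) passes from large squares to the plane.

  For the converse, take any tiling and assume that all orbits are finite.  The words to the right of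
  the origin in the rows above it belong to one orbit, so two of them coincide.  The strip between
  these rows has finite height, so its columns of states take finitely many values; two of them
  coincide, and the rectangle cut out in this way closes up to a torus
  (\<open>periodic_tiling_of_finite_orbits\<close>).\<close>


section \<open>Runs and the action on infinite words\<close>

abbreviation state_act :: "('q, 'a) mealy \<Rightarrow> 'q \<Rightarrow> (nat \<Rightarrow> 'a) \<Rightarrow> (nat \<Rightarrow> 'a)" where
  "state_act M q \<equiv> act_infinite (produce_word M q)"

definition word_tail :: "nat \<Rightarrow> (nat \<Rightarrow> 'a) \<Rightarrow> (nat \<Rightarrow> 'a)" where
  "word_tail l \<eta> = (\<lambda>n. \<eta> (l + n))"

lemma length_word_prefix [simp]: "length (word_prefix \<eta> n) = n"
  by (simp add: word_prefix_def)

lemma word_prefix_0 [simp]: "word_prefix \<eta> 0 = []"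
  by (simp add: word_prefix_def)

lemma word_prefix_Suc: "word_prefix \<eta> (Suc n) = word_prefix \<eta> n @ [\<eta> n]"
  by (simp add: word_prefix_def)

lemma word_prefix_add: "word_prefix \<eta> (l + n) = word_prefix \<eta> l @ word_prefix (word_tail l \<eta>) n"
  by (induction n) (simp_all add: word_prefix_Suc word_tail_def)

lemma take_word_prefix: "m \<le> n \<Longrightarrow> take m (word_prefix \<eta> n) = word_prefix \<eta> m"
  by (simp add: word_prefix_def take_map)

lemma next_state_word_Nil [simp]: "next_state_word M q [] = q"
  by (simp add: next_state_word_def)

lemma next_state_word_append:
  "next_state_word M q (u @ v) = next_state_word M (next_state_word M q u) v"
  by (simp add: next_state_word_def)

lemma next_state_word_Cons:
  "next_state_word M q (a # w) = next_state_word M (next_state M q a) w"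
  by (simp add: next_state_word_def)

lemma next_state_word_prefix_Suc:
  "next_state_word M q (word_prefix \<eta> (Suc n)) =
     next_state M (next_state_word M q (word_prefix \<eta> n)) (\<eta> n)"
  by (simp add: word_prefix_Suc next_state_word_append next_state_word_Cons)

lemma length_produce_word [simp]: "length (produce_word M q w) = length w"
  by (induction w arbitrary: q) simp_all

lemma produce_word_append:
  "produce_word M q (u @ v) = produce_word M q u @ produce_word M (next_state_word M q u) v"
  by (induction u arbitrary: q) (simp_all add: next_state_word_Cons)

lemma take_produce_word: "take n (produce_word M q w) = produce_word M q (take n w)"
  by (induction w arbitrary: q n) (simp_all add: take_Cons split: nat.split)

lemma state_act_nth:
  "state_act M q \<eta> n = produce M (next_state_word M q (word_prefix \<eta> n)) (\<eta> n)"
  by (simp add: act_infinite_def word_prefix_Suc produce_word_append nth_append)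

lemma word_tail_state_act:
  "word_tail l (state_act M q \<eta>) =
     state_act M (next_state_word M q (word_prefix \<eta> l)) (word_tail l \<eta>)"
proof
  fix n
  show "word_tail l (state_act M q \<eta>) n =
     state_act M (next_state_word M q (word_prefix \<eta> l)) (word_tail l \<eta>) n"
    by (simp add: state_act_nth word_prefix_add next_state_word_append)
       (simp add: word_tail_def state_act_nth word_prefix_add next_state_word_append)
qed

lemma next_state_word_sink: "is_sink M e \<Longrightarrow> next_state_word M e w = e"
  by (induction w) (simp_all add: next_state_word_Cons is_sink_def)

lemma state_act_sink: "is_sink M e \<Longrightarrow> state_act M e \<eta> = \<eta>"
  by (rule ext) (simp add: state_act_nth next_state_word_sink, simp add: is_sink_def)

lemma next_state_word_sink_mono:
  assumes "is_sink M e" "next_state_word M q (word_prefix \<eta> k) = e" "k \<le> n"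
  shows "next_state_word M q (word_prefix \<eta> n) = e"
proof -
  obtain j where "n = k + j" using assms(3) le_Suc_ex by blast
  then show ?thesis
    using assms by (simp add: word_prefix_add next_state_word_append next_state_word_sink)
qed

lemma inj_state_act:
  assumes "invertible_mealy M"
  shows "inj (state_act M q)"
proof (rule injI)
  fix \<eta> \<zeta> assume eq: "state_act M q \<eta> = state_act M q \<zeta>"
  have "\<eta> n = \<zeta> n" for n
  proof (induction n rule: less_induct)
    case (less n)
    then have "word_prefix \<eta> n = word_prefix \<zeta> n"
      by (simp add: word_prefix_def)
    moreover have "inj (produce M s)" for s
      using assms by (simp add: invertible_mealy_def bij_is_inj)
    ultimately show ?case
      using fun_cong[OF eq, of n] by (simp add: state_act_nth inj_eq)
  qed
  then show "\<eta> = \<zeta>" by blast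
qed

lemma bij_produce_word:
  assumes "invertible_mealy M"
  shows "bij (produce_word M q)"
proof (rule bijI)
  have bij: "bij (produce M s)" for s
    using assms by (simp add: invertible_mealy_def)
  show "inj (produce_word M q)"
  proof (rule injI)
    fix u v assume "produce_word M q u = produce_word M q v"
    then show "u = v"
    proof (induction u arbitrary: q v)
      case Nil
      then show ?case by (cases v) auto
    next
      case (Cons a u)
      then show ?case
        using bij by (cases v) (auto simp: bij_def inj_eq)
    qed
  qed
  have "\<exists>u. produce_word M q u = w" for w
  proof (induction w arbitrary: q)
    case Nil
    show ?case by (rule exI[of _ "[]"]) simp
  next
    case (Cons b w)
    obtain a where "produce M q a = b"
      using bij by (metis bij_pointE)
    moreover obtain u where "produce_word M (next_state M q a) u = w"
      using Cons by blast
    ultimately show ?case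
      by (intro exI[of _ "a # u"]) simp
  qed
  then show "surj (produce_word M q)"
    by (metis surjI)
qed


section \<open>Orbits\<close>

definition tree_automorphism :: "('a list \<Rightarrow> 'a list) \<Rightarrow> bool" where
  "tree_automorphism g \<longleftrightarrow>
     bij g \<and> (\<forall>w. length (g w) = length w) \<and> (\<forall>w n. take n (g w) = g (take n w))"

lemma tree_automorphism_id: "tree_automorphism (\<lambda>w. w)"
  by (simp add: tree_automorphism_def bij_id[unfolded id_def])

lemma tree_automorphism_produce_word:
  "invertible_mealy M \<Longrightarrow> tree_automorphism (produce_word M q)"
  by (simp add: tree_automorphism_def bij_produce_word take_produce_word)

lemma tree_automorphism_comp:
  "tree_automorphism g \<Longrightarrow> tree_automorphism h \<Longrightarrow> tree_automorphism (g \<circ> h)"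
  by (auto simp: tree_automorphism_def intro: bij_comp)

lemma tree_automorphism_inv:
  assumes "tree_automorphism g"
  shows "tree_automorphism (inv_into UNIV g)"
proof -
  have g: "bij g" "\<And>w. length (g w) = length w" "\<And>w n. take n (g w) = g (take n w)"
    using assms by (auto simp: tree_automorphism_def)
  have right: "g (inv_into UNIV g w) = w" for w
    using g(1) by (simp add: bij_is_surj surj_f_inv_f)
  have "length (inv_into UNIV g w) = length w" for w
    using g(2)[of "inv_into UNIV g w"] right by simp
  moreover have "take n (inv_into UNIV g w) = inv_into UNIV g (take n w)" for n w
  proof -
    have "g (take n (inv_into UNIV g w)) = take n w"
      using g(3)[of n "inv_into UNIV g w"] right by simp
    then show ?thesis
      using g(1) by (metis bij_is_inj inv_f_f)
  qed
  ultimately show ?thesis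
    using g(1) by (simp add: tree_automorphism_def bij_imp_bij_inv)
qed

lemma word_prefix_act_infinite:
  assumes "tree_automorphism g"
  shows "word_prefix (act_infinite g \<eta>) n = g (word_prefix \<eta> n)"
proof (rule nth_equalityI)
  have len: "\<And>w. length (g w) = length w" and tk: "\<And>w n. take n (g w) = g (take n w)"
    using assms by (auto simp: tree_automorphism_def)
  show "length (word_prefix (act_infinite g \<eta>) n) = length (g (word_prefix \<eta> n))"
    by (simp add: len)
  fix i assume "i < length (word_prefix (act_infinite g \<eta>) n)"
  then have i: "i < n" by simp
  then have "g (word_prefix \<eta> (Suc i)) = take (Suc i) (g (word_prefix \<eta> n))"
    by (simp add: tk take_word_prefix)
  moreover have "word_prefix (act_infinite g \<eta>) n ! i = act_infinite g \<eta> i"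
    using i by (simp add: word_prefix_def)
  ultimately show "word_prefix (act_infinite g \<eta>) n ! i = g (word_prefix \<eta> n) ! i"
    by (simp add: act_infinite_def)
qed

lemma act_infinite_comp:
  "tree_automorphism h \<Longrightarrow> act_infinite (g \<circ> h) \<eta> = act_infinite g (act_infinite h \<eta>)"
  by (rule ext) (simp add: act_infinite_def[of g] act_infinite_def[of "g \<circ> h"]
      word_prefix_act_infinite)

lemma act_infinite_id: "act_infinite (\<lambda>w. w) \<eta> = \<eta>"
  by (rule ext) (simp add: act_infinite_def word_prefix_Suc nth_append)

lemma act_infinite_inv:
  assumes "tree_automorphism g"
  shows "act_infinite g (act_infinite (inv_into UNIV g) \<eta>) = \<eta>"
    and "act_infinite (inv_into UNIV g) (act_infinite g \<eta>) = \<eta>"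
proof -
  have "bij g" using assms by (simp add: tree_automorphism_def)
  then have "g \<circ> inv_into UNIV g = (\<lambda>w. w)" "inv_into UNIV g \<circ> g = (\<lambda>w. w)"
    by (auto simp: fun_eq_iff bij_is_surj surj_f_inv_f bij_is_inj)
  then show "act_infinite g (act_infinite (inv_into UNIV g) \<eta>) = \<eta>"
    and "act_infinite (inv_into UNIV g) (act_infinite g \<eta>) = \<eta>"
    using act_infinite_comp[OF tree_automorphism_inv[OF assms], of g \<eta>]
      act_infinite_comp[OF assms, of "inv_into UNIV g" \<eta>]
    by (simp_all add: act_infinite_id)
qed

lemma Bij_UNIV_eq: "Bij UNIV = {f. bij f}"
  by (auto simp: Bij_def)

lemma BijGroup_UNIV_simps:
  "\<one>\<^bsub>BijGroup UNIV\<^esub> = (\<lambda>x. x)"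
  "bij f \<Longrightarrow> inv\<^bsub>BijGroup UNIV\<^esub> f = inv_into UNIV f"
  "bij f \<Longrightarrow> bij g \<Longrightarrow> f \<otimes>\<^bsub>BijGroup UNIV\<^esub> g = f \<circ> g"
proof -
  show "bij f \<Longrightarrow> inv\<^bsub>BijGroup UNIV\<^esub> f = inv_into UNIV f"
    by (simp add: inv_BijGroup Bij_UNIV_eq fun_eq_iff)
qed (simp_all add: BijGroup_def Bij_UNIV_eq compose_def fun_eq_iff)

lemma mealy_group_tree_automorphism:
  assumes "invertible_mealy M" "g \<in> mealy_group M"
  shows "tree_automorphism g"
  using assms(2) unfolding mealy_group_def
proof (induction rule: generate.induct)
  case one
  show ?case by (simp add: BijGroup_UNIV_simps tree_automorphism_id)
next
  case (incl h)
  then show ?case using assms(1) by (auto intro: tree_automorphism_produce_word)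
next
  case (inv h)
  then have "tree_automorphism h" using assms(1) by (auto intro: tree_automorphism_produce_word)
  then show ?case
    using tree_automorphism_inv by (simp add: BijGroup_UNIV_simps tree_automorphism_def)
next
  case (eng g h)
  then have "g \<otimes>\<^bsub>BijGroup UNIV\<^esub> h = g \<circ> h"
    by (simp add: BijGroup_UNIV_simps tree_automorphism_def)
  then show ?case using tree_automorphism_comp[OF eng(3,4)] by (simp only:)
qed

lemma mealy_group_comp_state:
  assumes "invertible_mealy M" "g \<in> mealy_group M"
  shows "produce_word M q \<circ> g \<in> mealy_group M"
    and "inv_into UNIV (produce_word M q) \<circ> g \<in> mealy_group M"
proof -
  have bij: "bij g" "bij (produce_word M q)" "bij (inv_into UNIV (produce_word M q))"
    using mealy_group_tree_automorphism[OF assms] bij_produce_word[OF assms(1)]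
    by (auto simp: tree_automorphism_def bij_imp_bij_inv)
  have "produce_word M q \<otimes>\<^bsub>BijGroup UNIV\<^esub> g \<in> mealy_group M"
    using assms(2) unfolding mealy_group_def by (blast intro: generate.eng generate.incl)
  moreover have "inv\<^bsub>BijGroup UNIV\<^esub> (produce_word M q) \<otimes>\<^bsub>BijGroup UNIV\<^esub> g \<in> mealy_group M"
    using assms(2) unfolding mealy_group_def by (blast intro: generate.eng generate.inv)
  ultimately show "produce_word M q \<circ> g \<in> mealy_group M"
    and "inv_into UNIV (produce_word M q) \<circ> g \<in> mealy_group M"
    using bij by (simp_all add: BijGroup_UNIV_simps)
qed

lemma mealy_orbit_refl: "\<xi> \<in> mealy_orbit M \<xi>"
proof -
  have "(\<lambda>w. w) \<in> mealy_group M"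
    unfolding mealy_group_def using generate.one[of "BijGroup UNIV"]
    by (simp add: BijGroup_UNIV_simps)
  then show ?thesis
    unfolding mealy_orbit_def using act_infinite_id[of \<xi>] by (metis imageI)
qed

lemma state_act_mem_orbit_iff:
  assumes "invertible_mealy M"
  shows "state_act M q \<eta> \<in> mealy_orbit M \<xi> \<longleftrightarrow> \<eta> \<in> mealy_orbit M \<xi>"
proof
  assume "\<eta> \<in> mealy_orbit M \<xi>"
  then obtain g where g: "g \<in> mealy_group M" "\<eta> = act_infinite g \<xi>"
    by (auto simp: mealy_orbit_def)
  then have "state_act M q \<eta> = act_infinite (produce_word M q \<circ> g) \<xi>"
    using mealy_group_tree_automorphism[OF assms] by (simp add: act_infinite_comp)
  then show "state_act M q \<eta> \<in> mealy_orbit M \<xi>"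
    using mealy_group_comp_state(1)[OF assms g(1)] by (auto simp: mealy_orbit_def)
next
  assume "state_act M q \<eta> \<in> mealy_orbit M \<xi>"
  then obtain g where g: "g \<in> mealy_group M" "state_act M q \<eta> = act_infinite g \<xi>"
    by (auto simp: mealy_orbit_def)
  have "\<eta> = act_infinite (inv_into UNIV (produce_word M q)) (state_act M q \<eta>)"
    by (simp add: act_infinite_inv tree_automorphism_produce_word assms)
  also have "\<dots> = act_infinite (inv_into UNIV (produce_word M q) \<circ> g) \<xi>"
    using mealy_group_tree_automorphism[OF assms g(1)] g(2) by (simp add: act_infinite_comp)
  finally show "\<eta> \<in> mealy_orbit M \<xi>"
    using mealy_group_comp_state(2)[OF assms g(1)] unfolding mealy_orbit_def by blast
qed

text \<open>The equivalence in \<open>closed\<close> stands for closure under the states and under their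
  inverses at once; it spares any mention of the inverse automaton.\<close>

lemma mealy_orbit_minimal:
  assumes "invertible_mealy M" "\<xi> \<in> C"
    and closed: "\<And>q \<eta>. state_act M q \<eta> \<in> C \<longleftrightarrow> \<eta> \<in> C"
  shows "mealy_orbit M \<xi> \<subseteq> C"
proof -
  have "\<forall>\<eta>\<in>C. act_infinite g \<eta> \<in> C" if "g \<in> mealy_group M" for g
    using that unfolding mealy_group_def
  proof (induction rule: generate.induct)
    case one
    show ?case by (simp add: BijGroup_UNIV_simps act_infinite_id)
  next
    case (incl h)
    then show ?case using closed by auto
  next
    case (inv h)
    then obtain q where h: "h = produce_word M q" by auto
    have tree: "tree_automorphism h"
      using h assms(1) by (simp add: tree_automorphism_produce_word)
    then have "inv\<^bsub>BijGroup UNIV\<^esub> h = inv_into UNIV h"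
      by (simp add: BijGroup_UNIV_simps tree_automorphism_def)
    then show ?case
      using closed[of q] act_infinite_inv(1)[OF tree] h by metis
  next
    case (eng g h)
    then have "tree_automorphism g" and tree: "tree_automorphism h"
      using mealy_group_tree_automorphism[OF assms(1)] by (auto simp: mealy_group_def)
    then have "g \<otimes>\<^bsub>BijGroup UNIV\<^esub> h = g \<circ> h"
      by (simp add: BijGroup_UNIV_simps tree_automorphism_def)
    then show ?case using eng(3,4) by (simp only: act_infinite_comp[OF tree]) blast
  qed
  then show ?thesis using assms(2) by (auto simp: mealy_orbit_def)
qed

definition forward_steps :: "('q, 'a) mealy \<Rightarrow> ((nat \<Rightarrow> 'a) \<times> (nat \<Rightarrow> 'a)) set" where
  "forward_steps M = {(\<eta>, state_act M q \<eta>) | \<eta> q. True}"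

lemma forward_orbit_subset:
  assumes "invertible_mealy M"
  shows "(forward_steps M)\<^sup>* `` {\<xi>} \<subseteq> mealy_orbit M \<xi>"
proof -
  have "\<eta> \<in> mealy_orbit M \<xi>" if "(\<xi>, \<eta>) \<in> (forward_steps M)\<^sup>*" for \<eta>
    using that
    by (induction rule: rtrancl_induct)
       (auto simp: forward_steps_def mealy_orbit_refl state_act_mem_orbit_iff[OF assms])
  then show ?thesis by auto
qed

text \<open>An injective self-map of a finite set is onto, so on a finite forward orbit the inverses of the
  states are available without leaving it.\<close>

lemma infinite_forward_orbit:
  assumes "invertible_mealy M" "infinite (mealy_orbit M \<xi>)"
  shows "infinite ((forward_steps M)\<^sup>* `` {\<xi>})"
proof
  define R where "R = (forward_steps M)\<^sup>* `` {\<xi>}"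
  assume "finite ((forward_steps M)\<^sup>* `` {\<xi>})"
  then have fin: "finite R" by (simp add: R_def)
  have fwd: "state_act M q \<eta> \<in> R" if "\<eta> \<in> R" for q \<eta>
    using that unfolding R_def
    by (auto intro: rtrancl_into_rtrancl simp: forward_steps_def)
  have bwd: "\<eta> \<in> R" if "state_act M q \<eta> \<in> R" for q \<eta>
  proof -
    have "state_act M q ` R = R"
      using fin fwd inj_state_act[OF assms(1), of q]
      by (intro endo_inj_surj) (auto intro: inj_on_subset)
    then have "state_act M q \<eta> \<in> state_act M q ` R"
      using that by (simp only:)
    then obtain \<zeta> where "\<zeta> \<in> R" "state_act M q \<eta> = state_act M q \<zeta>"
      by blast
    then show ?thesis
      using inj_state_act[OF assms(1), of q] by (simp add: inj_eq)
  qed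
  have "\<xi> \<in> R" by (simp add: R_def)
  then have "mealy_orbit M \<xi> \<subseteq> R"
    by (rule mealy_orbit_minimal[OF assms(1)]) (blast intro: fwd bwd)
  then show False using assms(2) fin finite_subset by blast
qed


section \<open>Balls of the Schreier graph and the bound on \<open>\<lambda>\<close>\<close>

lemma invertible_signed_mealy:
  assumes "invertible_mealy M"
  shows "invertible_mealy (signed_mealy M e)"
  unfolding invertible_mealy_def
proof
  fix s
  have "bij (produce M q)" for q
    using assms by (simp add: invertible_mealy_def)
  then show "bij (produce (signed_mealy M e) s)"
    by (cases s) (simp_all add: signed_mealy_def inverse_mealy_def bij_imp_bij_inv)
qed

lemma next_state_word_signed_Pos:
  "next_state_word (signed_mealy M e) (Pos q) w = Pos (next_state_word M q w)"
  by (induction w arbitrary: q) (simp_all add: next_state_word_Cons, simp add: signed_mealy_def)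

lemma produce_word_signed_Pos: "produce_word (signed_mealy M e) (Pos q) = produce_word M q"
proof
  fix w
  show "produce_word (signed_mealy M e) (Pos q) w = produce_word M q w"
    by (induction w arbitrary: q) (simp_all, simp_all add: signed_mealy_def)
qed

lemma state_edge:
  assumes "invertible_mealy M" "\<eta> \<in> mealy_orbit M \<xi>"
  shows "(\<eta>, Pos q, state_act M q \<eta>) \<in> sch_edges M e \<xi>"
  using assms by (simp add: sch_edges_def sch_vertices_def signed_states_def
      state_act_mem_orbit_iff produce_word_signed_Pos)

instance signed :: (finite) finite
proof
  have "(UNIV :: 'a signed set) = range Pos \<union> range Neg"
    by (metis UNIV_eq_I UnI1 UnI2 rangeI signed.exhaust)
  then show "finite (UNIV :: 'a signed set)" by (metis finite_Un finite_imageI finite)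
qed

text \<open>Adjacency is symmetric, so the edges of the states alone, traversed in both directions, already
  connect the orbit.\<close>

lemma sch_connected:
  assumes "invertible_mealy M" "\<eta> \<in> mealy_orbit M \<xi>"
  shows "(\<xi>, \<eta>) \<in> (sch_adj M e \<xi>)\<^sup>*"
proof -
  define C where "C = {\<eta> \<in> mealy_orbit M \<xi>. (\<xi>, \<eta>) \<in> (sch_adj M e \<xi>)\<^sup>*}"
  have "state_act M q \<eta> \<in> C \<longleftrightarrow> \<eta> \<in> C" for q \<eta>
  proof (cases "\<eta> \<in> mealy_orbit M \<xi>")
    case True
    then have "(\<eta>, state_act M q \<eta>) \<in> sch_adj M e \<xi>" "(state_act M q \<eta>, \<eta>) \<in> sch_adj M e \<xi>"
      using state_edge[OF assms(1) True] by (auto simp: sch_adj_def)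
    then show ?thesis
      unfolding C_def using True assms(1)
      by (auto simp: state_act_mem_orbit_iff intro: rtrancl_into_rtrancl)
  next
    case False
    then show ?thesis using assms(1) by (simp add: C_def state_act_mem_orbit_iff)
  qed
  then have "mealy_orbit M \<xi> \<subseteq> C"
    by (intro mealy_orbit_minimal[OF assms(1)]) (auto simp: C_def mealy_orbit_refl)
  then show ?thesis using assms(2) by (auto simp: C_def)
qed

lemma sch_dist_walk:
  assumes "invertible_mealy M" "\<eta> \<in> mealy_orbit M \<xi>"
  shows "(\<xi>, \<eta>) \<in> sch_adj M e \<xi> ^^ sch_dist M e \<xi> \<xi> \<eta>"
  unfolding sch_dist_def
  by (rule LeastI_ex) (use sch_connected[OF assms] rtrancl_imp_relpow in blast)

lemma finite_relpow_Image:
  fixes r :: "('b \<times> 'b) set"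
  assumes "\<And>x. finite (r `` {x})"
  shows "finite ((r ^^ n) `` {x})"
proof (induction n)
  case 0
  show ?case by simp
next
  case (Suc n)
  have "(r ^^ Suc n) `` {x} = (\<Union>y \<in> (r ^^ n) `` {x}. r `` {y})"
    by auto
  then show ?case using Suc assms by simp
qed

lemma finite_sch_adj_Image:
  fixes M :: "('q::finite, 'a) mealy"
  assumes "invertible_mealy M"
  shows "finite (sch_adj M e \<xi> `` {\<eta>})"
proof -
  let ?act = "state_act (signed_mealy M e)"
  have "sch_adj M e \<xi> `` {\<eta>} \<subseteq> (\<Union>s. {?act s \<eta>} \<union> ?act s -` {\<eta>})"
    by (auto simp: sch_adj_def sch_edges_def)
  moreover have "finite (?act s -` {\<eta>})" for s
    by (simp add: finite_vimageI inj_state_act invertible_signed_mealy assms)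
  ultimately show ?thesis
    by (auto elim!: finite_subset)
qed

text \<open>The maximum that defines \<open>\<psi>\<close> is an upper bound only of a finite set.  Finiteness of balls rests
  on two facts: the distance of a vertex is realised by a walk from \<open>\<xi>\<close>, and every vertex has
  finitely many neighbours, since there are finitely many signed states and each acts injectively.\<close>

lemma finite_sch_ball:
  fixes M :: "('q::finite, 'a) mealy"
  assumes "invertible_mealy M"
  shows "finite (sch_ball M e \<xi> n)"
proof -
  define A where "A = (\<Union>k\<le>Suc n. (sch_adj M e \<xi> ^^ k) `` {\<xi>})"
  have A: "\<eta> \<in> A" if edge: "(\<eta>, s, \<eta>') \<in> sch_edges M e \<xi>"
    and near: "sch_dist M e \<xi> \<xi> \<eta> \<le> n \<or> sch_dist M e \<xi> \<xi> \<eta>' \<le> n" for \<eta> s \<eta>'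
  proof -
    have V: "\<eta> \<in> mealy_orbit M \<xi>" "\<eta>' \<in> mealy_orbit M \<xi>"
      using edge by (auto simp: sch_edges_def sch_vertices_def)
    have reverse: "(\<eta>', \<eta>) \<in> sch_adj M e \<xi>"
      using edge by (auto simp: sch_adj_def)
    from near show ?thesis
    proof
      assume "sch_dist M e \<xi> \<xi> \<eta> \<le> n"
      then show ?thesis
        using sch_dist_walk[OF assms V(1), of e] by (force simp: A_def)
    next
      assume "sch_dist M e \<xi> \<xi> \<eta>' \<le> n"
      moreover have "(\<xi>, \<eta>) \<in> sch_adj M e \<xi> ^^ Suc (sch_dist M e \<xi> \<xi> \<eta>')"
        using sch_dist_walk[OF assms V(2), of e] reverse by auto
      ultimately show ?thesis
        unfolding A_def by (intro UN_I[of "Suc (sch_dist M e \<xi> \<xi> \<eta>')"]) auto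
    qed
  qed
  have "sch_ball M e \<xi> n \<subseteq>
      (\<lambda>(\<eta>, s). (\<eta>, s, state_act (signed_mealy M e) s \<eta>)) ` (A \<times> UNIV)"
    using A by (fastforce simp: sch_ball_def sch_edges_def)
  moreover have "finite A"
    unfolding A_def by (intro finite_UN_I finite_relpow_Image finite_sch_adj_Image[OF assms]) simp
  ultimately show ?thesis
    by (auto elim!: finite_subset)
qed

lemma edge_lambda_le_limit_psi:
  fixes M :: "('q::finite, 'a) mealy"
  assumes "invertible_mealy M" "f \<in> sch_edges M e \<xi>" "edge_lambda M e f = enat k"
    and lim: "(\<lambda>n. real (sch_psi M e \<xi> n)) \<longlonglongrightarrow> real l"
  shows "k \<le> l"
proof -
  obtain \<eta> s \<eta>' where f: "f = (\<eta>, s, \<eta>')" by (cases f)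
  define m where "m = sch_dist M e \<xi> \<xi> \<eta>"
  have "real k \<le> real (sch_psi M e \<xi> n)" if "n \<ge> m" for n
  proof -
    let ?K = "{k. \<exists>f \<in> sch_ball M e \<xi> n. edge_lambda M e f = enat k}"
    have "?K = enat -` (edge_lambda M e ` sch_ball M e \<xi> n)"
      by (auto simp: image_iff) (metis)+
    then have "finite ?K"
      using finite_sch_ball[OF assms(1)] by (simp add: finite_vimageI inj_def)
    moreover have "f \<in> sch_ball M e \<xi> n"
      using that assms(2) f by (auto simp: sch_ball_def m_def)
    ultimately show ?thesis
      unfolding sch_psi_def of_nat_le_iff using assms(3) by (intro Max_ge) auto
  qed
  then have "real k \<le> real l"
    by (intro LIMSEQ_le_const[OF lim]) blast
  then show ?thesis by simp
qed

text \<open>Once a run is in the sink it stays there, so a bound \<open>l\<close> on the finite values of \<open>\<lambda>\<close> means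
  that the position \<open>l\<close> alone decides whether a run ever meets the sink.\<close>

lemma sink_at_limit_psi:
  fixes M :: "('q::finite, 'a) mealy"
  assumes "invertible_mealy M" "is_sink M e" "\<eta> \<in> mealy_orbit M \<xi>"
    and lim: "(\<lambda>n. real (sch_psi M e \<xi> n)) \<longlonglongrightarrow> real l"
    and sink: "next_state_word M q (word_prefix \<eta> n) = e"
  shows "next_state_word M q (word_prefix \<eta> l) = e"
proof -
  define P where "P k \<longleftrightarrow> k \<ge> 1 \<and> next_state_word M q (word_prefix \<eta> k) = e" for k :: nat
  have ex: "\<exists>k. P k"
    using next_state_word_sink_mono[OF assms(2) sink, of "Suc n"] by (auto simp: P_def)
  let ?f = "(\<eta>, Pos q, state_act M q \<eta>)"
  have "edge_lambda M e ?f = enat (Least P)"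
    using ex by (simp add: edge_lambda_def next_state_word_signed_Pos P_def[abs_def])
  then have "Least P \<le> l"
    using edge_lambda_le_limit_psi[OF assms(1) state_edge[OF assms(1,3)] _ lim] by blast
  moreover have "P (Least P)" using ex by (rule LeastI_ex)
  ultimately show ?thesis
    using next_state_word_sink_mono[OF assms(2)] by (auto simp: P_def)
qed


section \<open>Sink-free walks\<close>

definition sink_free_steps :: "('q, 'a) mealy \<Rightarrow> 'q \<Rightarrow> ((nat \<Rightarrow> 'a) \<times> (nat \<Rightarrow> 'a)) set" where
  "sink_free_steps M e =
    {(\<zeta>, state_act M p \<zeta>) | \<zeta> p. \<forall>n. next_state_word M p (word_prefix \<zeta> n) \<noteq> e}"

text \<open>An edge with finite \<open>\<lambda>\<close> is invisible on tails, and an edge with infinite \<open>\<lambda>\<close> gives a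
  sink-free step, because the section at the prefix of length \<open>l\<close> inherits the rest of the run.\<close>

lemma bounded_lambda_step:
  fixes M :: "('q::finite, 'a) mealy"
  assumes "invertible_mealy M" "is_sink M e" "\<eta> \<in> mealy_orbit M \<xi>"
    and lim: "(\<lambda>n. real (sch_psi M e \<xi> n)) \<longlonglongrightarrow> real l"
  shows "(word_tail l \<eta>, word_tail l (state_act M q \<eta>)) \<in> (sink_free_steps M e)\<^sup>*"
proof (cases "next_state_word M q (word_prefix \<eta> l) = e")
  case True
  then show ?thesis by (simp add: word_tail_state_act state_act_sink[OF assms(2)])
next
  case False
  then have "next_state_word M q (word_prefix \<eta> (l + n)) \<noteq> e" for n
    using sink_at_limit_psi[OF assms] by blast
  then have "(word_tail l \<eta>, word_tail l (state_act M q \<eta>)) \<in> sink_free_steps M e"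
    unfolding sink_free_steps_def word_tail_state_act
    by (auto simp: word_prefix_add next_state_word_append)
  then show ?thesis by blast
qed

lemma finite_same_tail: "finite {\<eta> :: nat \<Rightarrow> 'a::finite. word_tail l \<eta> = \<zeta>}"
proof -
  have "inj_on (\<lambda>\<eta>. word_prefix \<eta> l) {\<eta> :: nat \<Rightarrow> 'a. word_tail l \<eta> = \<zeta>}"
  proof (rule inj_onI, rule ext)
    fix \<eta> \<eta>' :: "nat \<Rightarrow> 'a" and n
    assume "\<eta> \<in> {\<eta>. word_tail l \<eta> = \<zeta>}" "\<eta>' \<in> {\<eta>. word_tail l \<eta> = \<zeta>}"
      and pre: "word_prefix \<eta> l = word_prefix \<eta>' l"
    then have tail: "word_tail l \<eta> = word_tail l \<eta>'" by simp
    show "\<eta> n = \<eta>' n"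
    proof (cases "n < l")
      case True
      then show ?thesis using pre by (simp add: word_prefix_def)
    next
      case False
      then show ?thesis using fun_cong[OF tail, of "n - l"] by (simp add: word_tail_def)
    qed
  qed
  moreover have "finite ((\<lambda>\<eta>. word_prefix \<eta> l) ` {\<eta> :: nat \<Rightarrow> 'a. word_tail l \<eta> = \<zeta>})"
    by (rule finite_subset[OF _ finite_lists_length_eq[of "UNIV :: 'a set" l]]) auto
  ultimately show ?thesis by (rule finite_imageD[rotated])
qed

lemma infinite_sink_free_reach:
  fixes M :: "('q::finite, 'a::finite) mealy"
  assumes "invertible_mealy M" "is_sink M e" "infinite (mealy_orbit M \<xi>)"
    and lim: "(\<lambda>n. real (sch_psi M e \<xi> n)) \<longlonglongrightarrow> real l"
  shows "infinite ((sink_free_steps M e)\<^sup>* `` {word_tail l \<xi>})"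
proof -
  let ?R = "(forward_steps M)\<^sup>* `` {\<xi>}" and ?N = "(sink_free_steps M e)\<^sup>* `` {word_tail l \<xi>}"
  have "(word_tail l \<xi>, word_tail l \<eta>) \<in> (sink_free_steps M e)\<^sup>*"
    if "(\<xi>, \<eta>) \<in> (forward_steps M)\<^sup>*" for \<eta>
    using that
  proof (induction rule: rtrancl_induct)
    case base
    show ?case by simp
  next
    case (step \<eta> \<eta>')
    have "\<eta> \<in> mealy_orbit M \<xi>"
      using step(1) forward_orbit_subset[OF assms(1)] by blast
    with step show ?case
      using bounded_lambda_step[OF assms(1,2) _ lim]
      by (auto simp: forward_steps_def intro: rtrancl_trans)
  qed
  then have sub: "?R \<subseteq> (\<Union>\<zeta> \<in> ?N. {\<eta>. word_tail l \<eta> = \<zeta>})"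
    by auto
  show ?thesis
  proof
    assume "finite ?N"
    then have "finite (\<Union>\<zeta> \<in> ?N. {\<eta> :: nat \<Rightarrow> 'a. word_tail l \<eta> = \<zeta>})"
      using finite_same_tail by blast
    then show False
      using sub infinite_forward_orbit[OF assms(1,3)] finite_subset by blast
  qed
qed

lemma finite_sink_free_steps_Image:
  fixes M :: "('q::finite, 'a) mealy"
  shows "finite (sink_free_steps M e `` {\<zeta>})"
  by (rule finite_subset[of _ "range (\<lambda>p. state_act M p \<zeta>)"]) (auto simp: sink_free_steps_def)

lemma relpow_nonempty_of_infinite_reach:
  assumes fin: "\<And>x. finite (r `` {x})" and inf: "infinite (r\<^sup>* `` {x})"
  shows "(r ^^ n) `` {x} \<noteq> {}"
proof
  assume empty: "(r ^^ n) `` {x} = {}"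
  have stop: "(r ^^ (n + k)) `` {x} = {}" for k
  proof -
    have "(r ^^ (n + k)) `` {x} = (r ^^ k) `` ((r ^^ n) `` {x})"
      by (simp add: relpow_add relcomp_Image)
    then show ?thesis using empty by simp
  qed
  have "r\<^sup>* `` {x} \<subseteq> (\<Union>k<n. (r ^^ k) `` {x})"
  proof
    fix y assume "y \<in> r\<^sup>* `` {x}"
    then obtain k where k: "y \<in> (r ^^ k) `` {x}"
      using rtrancl_imp_relpow by blast
    then have "k < n"
      using stop[of "k - n"] by (cases "k < n") auto
    with k show "y \<in> (\<Union>k<n. (r ^^ k) `` {x})" by blast
  qed
  then show False
    using inf finite_subset finite_relpow_Image[OF fin] by blast
qed


section \<open>Tilings as space-time diagrams\<close>

text \<open>The east and north colours of a tile are determined by the other two, so a tiling is recorded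
  by the states \<open>S\<close> on west edges and the letters \<open>A\<close> on south edges.\<close>

definition space_time ::
    "('q, 'a) mealy \<Rightarrow> 'q \<Rightarrow> (int \<Rightarrow> int \<Rightarrow> 'q) \<Rightarrow> (int \<Rightarrow> int \<Rightarrow> 'a) \<Rightarrow> bool" where
  "space_time M e S A \<longleftrightarrow> (\<forall>x y. S x y \<noteq> e \<and> S (x + 1) y = next_state M (S x y) (A x y) \<and>
     A x (y + 1) = produce M (S x y) (A x y))"

definition diagram_tiling ::
    "('q, 'a) mealy \<Rightarrow> (int \<Rightarrow> int \<Rightarrow> 'q) \<Rightarrow> (int \<Rightarrow> int \<Rightarrow> 'a) \<Rightarrow> int \<times> int \<Rightarrow> ('q, 'a) wang_tile" where
  "diagram_tiling M S A = (\<lambda>(x, y). \<lparr>west = S x y, south = A x y,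
     east = next_state M (S x y) (A x y), north = produce M (S x y) (A x y)\<rparr>)"

lemma is_tiling_diagram_tiling:
  assumes "space_time M e S A"
  shows "is_tiling (mealy_tileset M e) (diagram_tiling M S A)"
proof -
  have D: "S x y \<noteq> e" "S (x + 1) y = next_state M (S x y) (A x y)"
    "A x (y + 1) = produce M (S x y) (A x y)" for x y
    using assms by (auto simp: space_time_def)
  have "diagram_tiling M S A (x, y) \<in> mealy_tileset M e" for x y
    using D(1)[of x y] D(1)[of "x + 1" y] D(2)[of x y]
    by (simp add: diagram_tiling_def mealy_tileset_def)
  then show ?thesis
    using D(2,3) by (auto simp: is_tiling_def diagram_tiling_def)
qed

lemma space_time_of_tiling:
  assumes "is_tiling (mealy_tileset M e) f"
  shows "space_time M e (\<lambda>x y. west (f (x, y))) (\<lambda>x y. south (f (x, y)))"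
proof -
  have "west (f (x, y)) \<noteq> e \<and> east (f (x, y)) = next_state M (west (f (x, y))) (south (f (x, y))) \<and>
      north (f (x, y)) = produce M (west (f (x, y))) (south (f (x, y)))" for x y
  proof -
    have "f (x, y) \<in> mealy_tileset M e"
      using assms by (auto simp: is_tiling_def)
    then show ?thesis by (auto simp: mealy_tileset_def)
  qed
  then show ?thesis
    using assms by (simp add: is_tiling_def space_time_def)
qed

text \<open>A diagonal argument over the countably many cells: along a suitable sequence of ever larger
  solved squares the colour of every single cell is eventually constant, and the limit colouring
  obeys the rule because the rule looks at three cells only.\<close>

lemma local_rule_compactness:
  fixes ok :: "'c::finite \<Rightarrow> 'c \<Rightarrow> 'c \<Rightarrow> bool"
  assumes "\<And>n. \<exists>F. \<forall>x y. \<bar>x\<bar> \<le> int n \<and> \<bar>y\<bar> \<le> int n \<longrightarrow>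
             ok (F (x, y)) (F (x + 1, y)) (F (x, y + 1))"
  shows "\<exists>G. \<forall>(x :: int) (y :: int). ok (G (x, y)) (G (x + 1, y)) (G (x, y + 1))"
proof -
  obtain F where F: "\<And>n x y. \<bar>x\<bar> \<le> int n \<Longrightarrow> \<bar>y\<bar> \<le> int n \<Longrightarrow>
      ok (F n (x, y)) (F n (x + 1, y)) (F n (x, y + 1))"
    using assms by metis
  interpret subseqs "\<lambda>k s. \<exists>c. \<forall>i. F (s i) (from_nat k) = c"
  proof
    fix k and s :: "nat \<Rightarrow> nat"
    have "\<exists>i0\<in>UNIV. infinite {i \<in> UNIV. F (s i) (from_nat k) = F (s i0) (from_nat k)}"
      by (rule pigeonhole_infinite) (auto intro: finite_subset[OF subset_UNIV])
    then obtain c where inf: "infinite {i. F (s i) (from_nat k) = c}" by auto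
    let ?r = "enumerate {i. F (s i) (from_nat k) = c}"
    have "strict_mono ?r" by (rule strict_mono_enumerate[OF inf])
    moreover have "F (s (?r i)) (from_nat k) = c" for i
      using enumerate_in_set[OF inf, of i] by simp
    ultimately show "\<exists>r :: nat \<Rightarrow> nat. strict_mono r \<and> (\<exists>c. \<forall>i. F ((s \<circ> r) i) (from_nat k) = c)"
      unfolding comp_def by (intro exI[of _ ?r] conjI exI[of _ c]) auto
  qed
  have stable: "\<exists>c. \<forall>i. F ((diagseq \<circ> (+) (Suc k)) i) (from_nat k) = c" for k
    by (rule diagseq_holds) auto
  have const: "\<exists>c. \<forall>i. F (diagseq (Suc (to_nat z) + i)) z = c" for z :: "int \<times> int"
    using stable[of "to_nat z"] by simp
  define G where "G z = F (diagseq (Suc (to_nat z))) z" for z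
  have G: "F (diagseq i) z = G z" if "i > to_nat z" for i z
  proof -
    obtain c where c: "\<And>m. F (diagseq (Suc (to_nat z) + m)) z = c"
      using const by blast
    have "Suc (to_nat z) + (i - Suc (to_nat z)) = i" using that by simp
    then show ?thesis
      using c[of "i - Suc (to_nat z)"] c[of 0] by (simp only: G_def add_0_right)
  qed
  have "ok (G (x, y)) (G (x + 1, y)) (G (x, y + 1))" for x y
  proof -
    define i where "i = Suc (to_nat (x, y) + to_nat (x + 1, y) + to_nat (x, y + 1)
      + nat \<bar>x\<bar> + nat \<bar>y\<bar>)"
    have le: "i \<le> diagseq i"
      using seq_suble[OF subseq_diagseq] .
    have "nat \<bar>x\<bar> \<le> i" "nat \<bar>y\<bar> \<le> i"
      by (simp_all add: i_def)
    then have "\<bar>x\<bar> \<le> int (diagseq i)" "\<bar>y\<bar> \<le> int (diagseq i)"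
      using le by linarith+
    then have "ok (F (diagseq i) (x, y)) (F (diagseq i) (x + 1, y)) (F (diagseq i) (x, y + 1))"
      by (rule F)
    then show ?thesis by (simp add: G i_def)
  qed
  then show ?thesis by blast
qed

lemma tiles_plane_of_long_walks:
  fixes M :: "('q::finite, 'a::finite) mealy"
  assumes "\<And>n. (sink_free_steps M e ^^ n) `` {\<zeta>} \<noteq> {}"
  shows "tiles_plane (mealy_tileset M e)"
proof -
  define ok where "ok c r u \<longleftrightarrow> fst c \<noteq> e \<and> fst r = next_state M (fst c) (snd c) \<and>
     snd u = produce M (fst c) (snd c)" for c r u :: "'q \<times> 'a"
  have "\<exists>F. \<forall>x y. \<bar>x\<bar> \<le> int n \<and> \<bar>y\<bar> \<le> int n \<longrightarrow>
          ok (F (x, y)) (F (x + 1, y)) (F (x, y + 1))" for n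
  proof -
    \<comment> \<open>\<open>Z j\<close> is the word below row \<open>j\<close>, and \<open>p j\<close> the state that enters the row at its left end.\<close>
    obtain \<zeta>' where "(\<zeta>, \<zeta>') \<in> sink_free_steps M e ^^ Suc (2 * n)"
      using assms[of "Suc (2 * n)"] by blast
    then obtain Z where Z: "\<And>j. j < Suc (2 * n) \<Longrightarrow> (Z j, Z (Suc j)) \<in> sink_free_steps M e"
      unfolding relpow_fun_conv by blast
    have "\<forall>j. \<exists>p. j < Suc (2 * n) \<longrightarrow> Z (Suc j) = state_act M p (Z j) \<and>
        (\<forall>m. next_state_word M p (word_prefix (Z j) m) \<noteq> e)"
      using Z by (fastforce simp: sink_free_steps_def)
    then obtain p where p: "\<And>j. j < Suc (2 * n) \<Longrightarrow> Z (Suc j) = state_act M (p j) (Z j)"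
      "\<And>j m. j < Suc (2 * n) \<Longrightarrow> next_state_word M (p j) (word_prefix (Z j) m) \<noteq> e"
      by metis
    \<comment> \<open>The walk starts at the corner \<open>(-n, -n)\<close>; the \<open>2 * n + 1\<close> steps reach the row above \<open>y = n\<close>.\<close>
    define F where "F = (\<lambda>(x, y). let i = nat (x + int n); j = nat (y + int n) in
        (next_state_word M (p j) (word_prefix (Z j) i), Z j i))"
    have "ok (F (x, y)) (F (x + 1, y)) (F (x, y + 1))"
      if "\<bar>x\<bar> \<le> int n" "\<bar>y\<bar> \<le> int n" for x y
    proof -
      have "nat (x + 1 + int n) = Suc (nat (x + int n))" "nat (y + 1 + int n) = Suc (nat (y + int n))"
        "nat (y + int n) < Suc (2 * n)"
        using that by auto
      then show ?thesis
        using p by (simp add: ok_def F_def Let_def next_state_word_prefix_Suc state_act_nth)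
    qed
    then show ?thesis by blast
  qed
  then have "\<exists>G. \<forall>(x :: int) (y :: int). ok (G (x, y)) (G (x + 1, y)) (G (x, y + 1))"
    by (rule local_rule_compactness)
  then obtain G :: "int \<times> int \<Rightarrow> 'q \<times> 'a" where
    "\<And>x y. ok (G (x, y)) (G (x + 1, y)) (G (x, y + 1))" by blast
  then have "space_time M e (\<lambda>x y. fst (G (x, y))) (\<lambda>x y. snd (G (x, y)))"
    by (simp add: space_time_def ok_def)
  then show ?thesis
    unfolding tiles_plane_def by (blast intro: is_tiling_diagram_tiling)
qed


section \<open>Periodic tilings from finite orbits\<close>

lemma space_time_rows:
  assumes "space_time M e S A"
  shows "next_state_word M (S 0 y) (word_prefix (\<lambda>n. A (int n) y) n) = S (int n) y"
    and "state_act M (S 0 y) (\<lambda>n. A (int n) y) = (\<lambda>n. A (int n) (y + 1))"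
proof -
  have D: "S (x + 1) y = next_state M (S x y) (A x y)"
    "A x (y + 1) = produce M (S x y) (A x y)" for x y
    using assms by (simp_all add: space_time_def)
  show run: "next_state_word M (S 0 y) (word_prefix (\<lambda>n. A (int n) y) n) = S (int n) y" for n
  proof (induction n)
    case 0
    show ?case by simp
  next
    case (Suc n)
    then show ?case
      using D(1)[of "int n" y] by (simp add: next_state_word_prefix_Suc add.commute)
  qed
  show "state_act M (S 0 y) (\<lambda>n. A (int n) y) = (\<lambda>n. A (int n) (y + 1))"
    by (rule ext) (simp add: state_act_nth run D(2))
qed

lemma mod_plus_one_cases:
  fixes x k :: int
  assumes "k > 0"
  obtains "(x + 1) mod k = x mod k + 1" | "(x + 1) mod k = 0" "x mod k + 1 = k"
proof (cases "x mod k + 1 = k")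
  case True
  then have "(x + 1) mod k = 0" by (metis mod_add_left_eq mod_self)
  from that(2)[OF this True] show thesis .
next
  case False
  then have "0 \<le> x mod k + 1" "x mod k + 1 < k"
    using pos_mod_bound[OF assms, of x] pos_mod_sign[OF assms, of x] by linarith+
  then have "(x + 1) mod k = x mod k + 1"
    by (metis mod_add_left_eq mod_pos_pos_trivial)
  then show thesis by (rule that(1))
qed

lemma periodic_tiling_of_finite_orbits:
  fixes M :: "('q::finite, 'a) mealy"
  assumes inv: "invertible_mealy M" and fin: "\<And>\<xi>. finite (mealy_orbit M \<xi>)"
    and til: "is_tiling (mealy_tileset M e) f"
  shows "\<exists>g. is_tiling (mealy_tileset M e) g \<and> periodic_tiling g"
proof -
  define S where "S = (\<lambda>x y. west (f (x, y)))"
  define A where "A = (\<lambda>x y. south (f (x, y)))"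
  have SA: "space_time M e S A"
    unfolding S_def A_def by (rule space_time_of_tiling[OF til])
  have D: "S x y \<noteq> e" "S (x + 1) y = next_state M (S x y) (A x y)"
    "A x (y + 1) = produce M (S x y) (A x y)" for x y
    using SA by (auto simp: space_time_def)
  define Z where "Z = (\<lambda>j n. A (int n) (int j))"
  have "Z j \<in> mealy_orbit M (Z 0)" for j
  proof (induction j)
    case 0
    show ?case by (rule mealy_orbit_refl)
  next
    case (Suc j)
    have "Z (Suc j) = state_act M (S 0 (int j)) (Z j)"
      using space_time_rows(2)[OF SA, of "int j"] by (simp add: Z_def add.commute)
    then show ?case using Suc inv by (simp add: state_act_mem_orbit_iff)
  qed
  then have "finite (range Z)"
    using fin[of "Z 0"] by (meson finite_subset image_subsetI)
  then have "\<not> inj Z" using finite_imageD by blast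
  then obtain i j where ij: "i < j" "Z i = Z j"
    by (metis injI linorder_neqE_nat)
  define h where "h = j - i"
  have h: "h > 0" "int i + int h = int j" using ij by (auto simp: h_def)
  \<comment> \<open>Two columns of west states that agree between the equal rows bound a rectangle whose opposite
      sides carry the same colours.\<close>
  define col where "col = (\<lambda>n. map (\<lambda>y. S (int n) (int i + int y)) [0..<h])"
  have "finite (range col)"
    by (rule finite_subset[OF _ finite_lists_length_eq[of "UNIV :: 'q set" h]])
       (auto simp: col_def)
  then have "\<not> inj col" using finite_imageD by blast
  then obtain a b where ab: "a < b" "col a = col b"
    by (metis injI linorder_neqE_nat)
  define k where "k = b - a"
  have k: "k > 0" "int a + int k = int b" using ab by (auto simp: k_def)
  have rows: "A (int a + x) (int i + int h) = A (int a + x) (int i)" if "x \<ge> 0" for x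
  proof -
    have "int (a + nat x) = int a + x" using that by simp
    then show ?thesis
      using fun_cong[OF ij(2), of "a + nat x"] h(2) by (simp add: Z_def)
  qed
  have cols: "S (int a + int k) (int i + y) = S (int a) (int i + y)" if "0 \<le> y" "y < int h" for y
  proof -
    have "nat y < h" using that by auto
    then have "col a ! nat y = S (int a) (int i + y)" "col b ! nat y = S (int b) (int i + y)"
      using that by (simp_all add: col_def)
    then show ?thesis using ab(2) k(2) by simp
  qed
  define S' where "S' = (\<lambda>x y. S (int a + x mod int k) (int i + y mod int h))"
  define A' where "A' = (\<lambda>x y. A (int a + x mod int k) (int i + y mod int h))"
  have "space_time M e S' A'"
    unfolding space_time_def
  proof (intro allI conjI)
    fix x y
    let ?x = "x mod int k" and ?y = "y mod int h"
    have bounds: "0 \<le> ?x" "0 \<le> ?y" "?y < int h" using h(1) k(1) by auto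
    show "S' x y \<noteq> e" by (simp add: S'_def D)
    have "S' (x + 1) y = S (int a + ?x + 1) (int i + ?y)"
      by (rule mod_plus_one_cases[of "int k" x])
         (use k(1) cols[OF bounds(2,3)] in \<open>auto simp: S'_def add.assoc\<close>)
    then show "S' (x + 1) y = next_state M (S' x y) (A' x y)"
      by (simp add: S'_def A'_def D)
    have "A' x (y + 1) = A (int a + ?x) (int i + ?y + 1)"
      by (rule mod_plus_one_cases[of "int h" y])
         (use h(1) rows[OF bounds(1)] in \<open>auto simp: A'_def add.assoc\<close>)
    then show "A' x (y + 1) = produce M (S' x y) (A' x y)"
      by (simp add: S'_def A'_def D)
  qed
  then have "is_tiling (mealy_tileset M e) (diagram_tiling M S' A')"
    by (rule is_tiling_diagram_tiling)
  moreover have "diagram_tiling M S' A' (t + (int k, 0)) = diagram_tiling M S' A' t" for t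
    by (cases t) (simp add: diagram_tiling_def S'_def A'_def)
  then have "periodic_tiling (diagram_tiling M S' A')"
    unfolding periodic_tiling_def using k(1)
    by (intro exI[of _ "(int k, 0)"]) (auto simp: zero_prod_def)
  ultimately show ?thesis by blast
qed


section \<open>Tilings and infinite Schreier graphs\<close>

theorem proposition6p9:
  fixes M :: "('q::finite, 'a::finite) mealy" and e :: 'q
  assumes "M \<in> class_Sa" and "is_sink M e"
  shows "((\<exists>\<xi>. infinite (sch_vertices M \<xi>) \<and>
              (\<exists>l::nat. l \<ge> 1 \<and> (\<lambda>n. real (sch_psi M e \<xi> n)) \<longlonglongrightarrow> real l))
           \<longrightarrow> tiles_plane (mealy_tileset M e))
       \<and> (tiles_plane (mealy_tileset M e) \<and>
            (\<forall>f. is_tiling (mealy_tileset M e) f \<longrightarrow> \<not> periodic_tiling f)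
           \<longrightarrow> (\<exists>\<xi>. infinite (sch_vertices M \<xi>)))"
proof (intro conjI impI)
  have inv: "invertible_mealy M" using assms(1) by (simp add: class_Sa_def)
  {
    assume "\<exists>\<xi>. infinite (sch_vertices M \<xi>) \<and>
              (\<exists>l::nat. l \<ge> 1 \<and> (\<lambda>n. real (sch_psi M e \<xi> n)) \<longlonglongrightarrow> real l)"
    then obtain \<xi> l where "infinite (mealy_orbit M \<xi>)"
      "(\<lambda>n. real (sch_psi M e \<xi> n)) \<longlonglongrightarrow> real l"
      by (auto simp: sch_vertices_def)
    then have "infinite ((sink_free_steps M e)\<^sup>* `` {word_tail l \<xi>})"
      by (rule infinite_sink_free_reach[OF inv assms(2)])
    then show "tiles_plane (mealy_tileset M e)"
      using relpow_nonempty_of_infinite_reach[OF finite_sink_free_steps_Image]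
        tiles_plane_of_long_walks by metis
  }
  {
    assume "tiles_plane (mealy_tileset M e) \<and>
            (\<forall>f. is_tiling (mealy_tileset M e) f \<longrightarrow> \<not> periodic_tiling f)"
    then show "\<exists>\<xi>. infinite (sch_vertices M \<xi>)"
      using periodic_tiling_of_finite_orbits[OF inv] unfolding tiles_plane_def sch_vertices_def
      by metis
  }
qed

end
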